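(* Let $G=(V,E,\omega,\mu)$ be a finite weighted undirected graph with $V=\{1,\dots,n\}$, and let $d\ge 1$. There exist constants $C_1,C_2>0$, depending only on $G$ and $d$, such that the following holds. Let $X_0\in\mathbb{R}^{n\times d}$ be any initial feature, and let $(X_t)_{t\ge 0}$ be a differentiable curve in $\mathbb{R}^{n\times d}$ starting at $X_0$ and solving the non-local diffusion equation $$\frac{\partial X_t}{\partial t}=\left(\int_{G}\vert\Delta_{\mu} X_t\vert^2\,d\mu\right)\Delta_{\mu} X_t ,\qquad t\ge 0 .$$ Then for all $t>0$, $$\min\left(C_2\int_{G}\vert\nabla_{\mu}X_0\vert^2\,d\mu,\; C_2\frac{1}{t}\right)\;\leq\; \int_{G}\vert\nabla_{\mu}X_t\vert^2\,d\mu\;\leq\; C_1\frac{1}{t}.$$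
   Context: A weighted undirected graph $G=(V,E,\omega,\mu)$ consists of a vertex set $V$ (here $V=[n]=\{1,\dots,n\}$), an edge set $E$ (undirected, no loops; write $i\sim j$ if $i$ and $j$ are joined by an edge), a symmetric edge weight $\omega_{ij}=\omega_{ji}>0$ for $i\sim j$, and a vertex measure $\mu$ with $\mu_i=\mu(i)>0$ for every $i\in V$. A matrix $X\in\mathbb{R}^{n\times d}$ is identified with the function $X:V\to\mathbb{R}^d$ whose value $X(i)$ is the $i$-th row. The weighted Laplacian is $$\Delta_{\mu}X(i)=\sum_{j\sim i}\frac{\omega_{ij}}{\mu_i}\,(X(j)-X(i)).$$ The squared gradient is the real-valued function $$\vert\nabla_{\mu}X\vert^2(i)=\sum_{j\sim i}\frac{\omega_{ij}}{\mu_i}\,\vert X(j)-X(i)\vert^2 ,$$ where $\vert\cdot\vert$ is the Euclidean norm on $\mathbb{R}^d$, and $\vert\Delta_\mu X\vert^2(i)=\vert\Delta_\mu X(i)\vert^2$. For a function $f$ on $V$, $\int_G f\,d\mu=\sum_{i\in V} f(i)\mu_i$. *)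

theory Defs
  imports "HOL-Analysis.Analysis"
begin

text \<open>
  The vertex set is the whole finite type \<open>'n\<close>, so \<open>n = CARD('n)\<close>, and an \<open>n \<times> d\<close> real
  feature matrix is an element of \<open>real ^ 'd ^ 'n\<close>, whose row at vertex \<open>i\<close> is
  \<open>X $ i\<close> with its Euclidean norm. Edges are unordered pairs of distinct vertices.
  The values of \<open>weight\<close> off the edges are irrelevant.
\<close>

record 'n wgraph =
  edges :: "'n set set"
  weight :: "'n \<Rightarrow> 'n \<Rightarrow> real"
  vmeasure :: "'n \<Rightarrow> real"

definition adjacent :: "'n wgraph \<Rightarrow> 'n \<Rightarrow> 'n \<Rightarrow> bool" where
  "adjacent G i j \<longleftrightarrow> {i, j} \<in> edges G"

definition weighted_graph :: "'n wgraph \<Rightarrow> bool" where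
  "weighted_graph G \<longleftrightarrow>
     (\<forall>e\<in>edges G. card e = 2) \<and>
     (\<forall>i j. adjacent G i j \<longrightarrow> weight G i j = weight G j i \<and> weight G i j > 0) \<and>
     (\<forall>i. vmeasure G i > 0)"

definition laplacian :: "'n::finite wgraph \<Rightarrow> real ^ 'd ^ 'n \<Rightarrow> real ^ 'd ^ 'n" where
  "laplacian G X =
     (\<chi> i. \<Sum>j | adjacent G i j. (weight G i j / vmeasure G i) *\<^sub>R (X $ j - X $ i))"

definition sq_gradient :: "'n::finite wgraph \<Rightarrow> real ^ 'd ^ 'n \<Rightarrow> 'n \<Rightarrow> real" where
  "sq_gradient G X i =
     (\<Sum>j | adjacent G i j. weight G i j / vmeasure G i * (norm (X $ j - X $ i))\<^sup>2)"

definition sq_laplacian :: "'n::finite wgraph \<Rightarrow> real ^ 'd ^ 'n \<Rightarrow> 'n \<Rightarrow> real" where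
  "sq_laplacian G X i = (norm (laplacian G X $ i))\<^sup>2"

definition graph_integral :: "'n::finite wgraph \<Rightarrow> ('n \<Rightarrow> real) \<Rightarrow> real" where
  "graph_integral G f = (\<Sum>i\<in>UNIV. f i * vmeasure G i)"

end

theory Submission imports Defs begin

text \<open>
  The Dirichlet energy \<open>y\<close> of the solution satisfies \<open>y' = - 4 L\<^sup>2\<close>, where \<open>L\<close> is the integral of
  the squared Laplacian. Both \<open>L\<close> and the energy are quadratic forms with the same kernel, so
  each is bounded by a multiple of the other, and \<open>y\<close> is squeezed between two Riccati
  equations \<open>y' = - c y\<^sup>2\<close>.
\<close>

abbreviation energy :: "'n::finite wgraph \<Rightarrow> real ^ 'd ^ 'n \<Rightarrow> real" where
  "energy G X \<equiv> graph_integral G (sq_gradient G X)"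

abbreviation total_sq_laplacian :: "'n::finite wgraph \<Rightarrow> real ^ 'd ^ 'n \<Rightarrow> real" where
  "total_sq_laplacian G X \<equiv> graph_integral G (sq_laplacian G X)"

section \<open>Scalar differential inequalities\<close>

text \<open>The mean value theorem in the form suited to a flow on the half line: the derivative is
  one-sided at 0, where continuity alone suffices, and two-sided at interior points.\<close>

lemma nonneg_deriv_imp_le:
  fixes f :: "real \<Rightarrow> real"
  assumes der: "\<And>s. 0 \<le> s \<Longrightarrow> s \<le> t \<Longrightarrow> (f has_real_derivative f' s) (at s within {0..})"
    and nonneg: "\<And>s. 0 \<le> s \<Longrightarrow> s \<le> t \<Longrightarrow> f' s \<ge> 0"
    and "0 \<le> t"
  shows "f 0 \<le> f t"
proof (rule DERIV_nonneg_imp_increasing_open[OF \<open>0 \<le> t\<close>])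
  show "\<exists>y. DERIV f s :> y \<and> 0 \<le> y" if "0 < s" "s < t" for s
  proof -
    have "at s within {0..} = at s"
      using that by (intro at_within_interior) auto
    then show ?thesis
      using der[of s] nonneg[of s] that by auto
  qed
  have "continuous (at s within {0..t}) f" if "s \<in> {0..t}" for s
    using DERIV_continuous[OF der[of s]] that
    by (auto intro: continuous_within_subset)
  then show "continuous_on {0..t} f"
    using continuous_on_eq_continuous_within by blast
qed

text \<open>As long as \<open>y\<close> is positive, \<open>1 / y\<close> has derivative
  \<open>- y' / y\<^sup>2\<close>, which lies between \<open>a\<close> and \<open>b\<close>, so
  \<open>1 / y\<close> grows at least and at most linearly. If \<open>y 0\<close> vanishes,
  monotonicity keeps \<open>y\<close> at zero and both bounds are trivial.\<close>

lemma riccati_bounds: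
  fixes y y' :: "real \<Rightarrow> real"
  assumes der: "\<And>s. 0 \<le> s \<Longrightarrow> (y has_real_derivative y' s) (at s within {0..})"
    and nonneg: "\<And>s. 0 \<le> s \<Longrightarrow> y s \<ge> 0"
    and upper: "\<And>s. 0 \<le> s \<Longrightarrow> y' s \<le> - a * (y s)\<^sup>2"
    and lower: "\<And>s. 0 \<le> s \<Longrightarrow> - b * (y s)\<^sup>2 \<le> y' s"
    and "a > 0" "b > 0" "t > 0"
  shows "y t \<le> 1 / (a * t)" "min (y 0 / 2) (1 / (2 * b * t)) \<le> y t"
proof -
  have le0: "y s \<le> y 0" if "0 \<le> s" for s
  proof -
    have "- y 0 \<le> - y s"
    proof (rule nonneg_deriv_imp_le[where f' = "\<lambda>s. - y' s"])
      show "((\<lambda>s. - y s) has_real_derivative - y' r) (at r within {0..})" if "0 \<le> r" for r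
        using der[OF that] by (rule DERIV_minus)
      show "0 \<le> - y' r" if "0 \<le> r" for r
      proof -
        have "0 \<le> a * (y r)\<^sup>2" using \<open>a > 0\<close> by simp
        then show ?thesis using upper[OF that] by simp
      qed
    qed (use that in auto)
    then show ?thesis by simp
  qed
  \<comment> \<open>Positivity is needed before passing to \<open>1 / y\<close>. Since
    \<open>0 \<le> y \<le> y 0\<close>, the quadratic bound gives the linear one
    \<open>y' \<ge> - b * y 0 * y\<close>, and with the integrating factor
    \<open>exp (b * y 0 * s)\<close> the product is nondecreasing.\<close>
  have positive: "y s > 0" if "0 \<le> s" "y 0 > 0" for s
  proof -
    let ?k = "b * y 0"
    have "y 0 * exp (?k * 0) \<le> y s * exp (?k * s)"
    proof (rule nonneg_deriv_imp_le[where f' = "\<lambda>r. (y' r + ?k * y r) * exp (?k * r)"])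
      show "((\<lambda>r. y r * exp (?k * r)) has_real_derivative (y' r + ?k * y r) * exp (?k * r))
          (at r within {0..})" if "0 \<le> r" for r
        by (rule derivative_eq_intros der[OF that] refl)+ (simp add: algebra_simps)
      show "0 \<le> (y' r + ?k * y r) * exp (?k * r)" if "0 \<le> r" for r
      proof -
        have "b * (y r * y r) \<le> b * (y 0 * y r)"
          using le0[OF that] nonneg[OF that] \<open>b > 0\<close> by (simp add: mult_right_mono)
        then have "0 \<le> y' r + ?k * y r"
          using lower[OF that] by (simp add: power2_eq_square algebra_simps)
        then show ?thesis by simp
      qed
    qed (use that in auto)
    then have "0 < y s * exp (?k * s)" using that by simp
    then show ?thesis by (simp add: zero_less_mult_iff)
  qed
  \<comment> \<open>Integrate the bounds on the derivative of \<open>1 / y\<close> over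
    \<open>[0, t]\<close>; the positive term \<open>1 / y 0\<close> is dropped on the left.\<close>
  have inverse_bounds: "a * t \<le> 1 / y t \<and> 1 / y t \<le> 1 / y 0 + b * t" if "y 0 > 0"
  proof
    have der_inv: "((\<lambda>r. 1 / y r) has_real_derivative - y' r / (y r)\<^sup>2) (at r within {0..})"
      if "0 \<le> r" for r
      by (rule derivative_eq_intros der[OF that] refl)+
        (use positive[OF that \<open>y 0 > 0\<close>] in \<open>auto simp: power2_eq_square\<close>)
    have "1 / y 0 - a * 0 \<le> 1 / y t - a * t"
    proof (rule nonneg_deriv_imp_le[where f' = "\<lambda>r. - y' r / (y r)\<^sup>2 - a"])
      show "((\<lambda>r. 1 / y r - a * r) has_real_derivative - y' r / (y r)\<^sup>2 - a) (at r within {0..})"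
        if "0 \<le> r" for r
        by (rule derivative_eq_intros der_inv[OF that] refl)+ simp
      show "0 \<le> - y' r / (y r)\<^sup>2 - a" if "0 \<le> r" for r
        using upper[OF that] positive[OF that \<open>y 0 > 0\<close>] by (simp add: field_simps)
    qed (use \<open>t > 0\<close> in auto)
    moreover have "0 < 1 / y 0" using that by simp
    ultimately show "a * t \<le> 1 / y t" by linarith
    have "b * 0 - 1 / y 0 \<le> b * t - 1 / y t"
    proof (rule nonneg_deriv_imp_le[where f' = "\<lambda>r. b - - y' r / (y r)\<^sup>2"])
      show "((\<lambda>r. b * r - 1 / y r) has_real_derivative b - - y' r / (y r)\<^sup>2) (at r within {0..})"
        if "0 \<le> r" for r
        by (rule derivative_eq_intros der_inv[OF that] refl)+ simp
      show "0 \<le> b - - y' r / (y r)\<^sup>2" if "0 \<le> r" for r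
        using lower[OF that] positive[OF that \<open>y 0 > 0\<close>] by (simp add: field_simps)
    qed (use \<open>t > 0\<close> in auto)
    then show "1 / y t \<le> 1 / y 0 + b * t" by simp
  qed
  show "y t \<le> 1 / (a * t)"
  proof (cases "y 0 > 0")
    case True
    then show ?thesis
      using inverse_bounds positive[of t] \<open>a > 0\<close> \<open>t > 0\<close> by (simp add: field_simps)
  next
    case False
    moreover have "0 < 1 / (a * t)" using \<open>a > 0\<close> \<open>t > 0\<close> by simp
    ultimately show ?thesis using le0[of t] \<open>t > 0\<close> by linarith
  qed
  show "min (y 0 / 2) (1 / (2 * b * t)) \<le> y t"
  proof (cases "y 0 > 0")
    case True
    then have yt: "y t > 0" using positive \<open>t > 0\<close> by simp
    \<comment> \<open>The sum \<open>1 / y 0 + b * t\<close> is at most twice its larger term. This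
      is the origin of both factors 1/2, and the case split decides which term is the
      larger.\<close>
    show ?thesis
    proof (cases "b * t \<le> 1 / y 0")
      case inv: True
      then have "1 / y t \<le> 2 / y 0" using inverse_bounds[OF True] by simp
      then have "y 0 / 2 \<le> y t" using yt True by (simp add: field_simps)
      then show ?thesis by simp
    next
      case False
      then have "1 / y t \<le> 2 * b * t" using inverse_bounds[OF True] by simp
      then have "1 / (2 * b * t) \<le> y t"
        using yt \<open>b > 0\<close> \<open>t > 0\<close> by (simp add: field_simps)
      then show ?thesis by simp
    qed
  next
    case False
    then show ?thesis using nonneg[of t] \<open>t > 0\<close> by linarith
  qed
qed

section \<open>Summation over edges and Green's formula\<close>

lemma adjacent_commute: "adjacent G i j \<longleftrightarrow> adjacent G j i"
  by (simp add: adjacent_def insert_commute)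

text \<open>Every edge is counted once in each orientation, so exchanging its endpoints only
  permutes the terms.\<close>

lemma sum_adjacent_swap:
  fixes G :: "'n::finite wgraph"
  shows "(\<Sum>i\<in>UNIV. \<Sum>j | adjacent G i j. f i j) = (\<Sum>i\<in>UNIV. \<Sum>j | adjacent G i j. f j i)"
  using sum.swap_restrict[of UNIV UNIV f "adjacent G"]
  by (simp add: adjacent_commute)

context
  fixes G :: "'n::finite wgraph"
  assumes G: "weighted_graph G"
begin

lemma vmeasure_pos: "vmeasure G i > 0"
  and weight_pos: "adjacent G i j \<Longrightarrow> weight G i j > 0"
  and weight_commute: "adjacent G i j \<Longrightarrow> weight G j i = weight G i j"
  using G unfolding weighted_graph_def by (blast, blast, metis)

text \<open>The vertex measure cancels, leaving a sum over oriented edges in which each undirected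
  edge appears twice.\<close>

lemma energy_eq:
  "energy G X = (\<Sum>i\<in>UNIV. \<Sum>j | adjacent G i j. weight G i j * (norm (X $ j - X $ i))\<^sup>2)"
  unfolding graph_integral_def sq_gradient_def sum_distrib_right
  using vmeasure_pos by (intro sum.cong refl) (simp add: less_imp_neq[symmetric])

lemma energy_nonneg: "energy G X \<ge> 0"
  unfolding energy_eq by (intro sum_nonneg) (auto simp: weight_pos less_imp_le)

lemma total_sq_laplacian_nonneg: "total_sq_laplacian G X \<ge> 0"
  unfolding graph_integral_def sq_laplacian_def
  by (intro sum_nonneg) (auto simp: vmeasure_pos less_imp_le)

lemma vmeasure_scaleR_laplacian:
  "vmeasure G i *\<^sub>R laplacian G X $ i = (\<Sum>j | adjacent G i j. weight G i j *\<^sub>R (X $ j - X $ i))"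
  using vmeasure_pos[of i] by (simp add: laplacian_def scaleR_sum_right)

text \<open>Discrete Green's formula. Split \<open>Y $ j - Y $ i\<close> into two sums; reversing
  the orientation of the edges changes the sign of the difference of \<open>X\<close> and turns the
  first sum into minus the second, hence the factor 2.\<close>

lemma summation_by_parts:
  "(\<Sum>i\<in>UNIV. \<Sum>j | adjacent G i j. weight G i j * ((X $ j - X $ i) \<bullet> (Y $ j - Y $ i)))
   = - 2 * (\<Sum>i\<in>UNIV. vmeasure G i * (laplacian G X $ i \<bullet> Y $ i))"
proof -
  let ?S = "\<lambda>f. \<Sum>i\<in>UNIV. \<Sum>j | adjacent G i j. weight G i j * f i j"
  have "?S (\<lambda>i j. (X $ j - X $ i) \<bullet> Y $ j)
      = (\<Sum>i\<in>UNIV. \<Sum>j | adjacent G i j. weight G j i * ((X $ i - X $ j) \<bullet> Y $ i))"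
    by (rule sum_adjacent_swap)
  also have "\<dots> = - ?S (\<lambda>i j. (X $ j - X $ i) \<bullet> Y $ i)"
    unfolding sum_negf[symmetric]
    by (intro sum.cong refl) (auto simp: weight_commute inner_diff_left algebra_simps)
  finally have swap: "?S (\<lambda>i j. (X $ j - X $ i) \<bullet> Y $ j) = - ?S (\<lambda>i j. (X $ j - X $ i) \<bullet> Y $ i)" .
  have "?S (\<lambda>i j. (X $ j - X $ i) \<bullet> (Y $ j - Y $ i))
      = ?S (\<lambda>i j. (X $ j - X $ i) \<bullet> Y $ j) - ?S (\<lambda>i j. (X $ j - X $ i) \<bullet> Y $ i)"
    by (simp add: inner_diff_right right_diff_distrib sum_subtractf)
  also have "\<dots> = - 2 * ?S (\<lambda>i j. (X $ j - X $ i) \<bullet> Y $ i)"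
    unfolding swap by simp
  also have "?S (\<lambda>i j. (X $ j - X $ i) \<bullet> Y $ i)
      = (\<Sum>i\<in>UNIV. vmeasure G i * (laplacian G X $ i \<bullet> Y $ i))"
    by (simp only: inner_scaleR_left[symmetric] vmeasure_scaleR_laplacian inner_sum_left)
  finally show ?thesis .
qed

lemma linear_laplacian: "linear (laplacian G :: real ^ 'd::finite ^ 'n \<Rightarrow> _)"
proof (rule linearI)
  show "laplacian G (X + Y) = laplacian G X + laplacian G Y" for X Y :: "real ^ 'd ^ 'n"
    unfolding laplacian_def vec_eq_iff[where 'b = 'n]
    by (simp only: vec_lambda_beta vector_add_component add_diff_add scaleR_add_right sum.distrib) simp
  show "laplacian G (c *\<^sub>R X) = c *\<^sub>R laplacian G X" for c and X :: "real ^ 'd ^ 'n"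
    unfolding laplacian_def vec_eq_iff[where 'b = 'n]
    by (simp add: scaleR_sum_right mult.commute flip: scaleR_diff_right)
qed

section \<open>Comparison of the energy with the integrated squared Laplacian\<close>

lemma weight_diff_le_energy:
  assumes "adjacent G i j"
  shows "weight G i j * (norm (X $ j - X $ i))\<^sup>2 \<le> energy G X"
proof -
  let ?f = "\<lambda>i j. weight G i j * (norm (X $ j - X $ i))\<^sup>2"
  have nonneg: "adjacent G i j \<Longrightarrow> 0 \<le> ?f i j" for i j
    by (simp add: weight_pos less_imp_le)
  have "?f i j \<le> (\<Sum>j | adjacent G i j. ?f i j)"
    using assms nonneg by (intro member_le_sum) auto
  also have "\<dots> \<le> energy G X"
    unfolding energy_eq using nonneg
    by (intro member_le_sum[where f = "\<lambda>i. \<Sum>j | adjacent G i j. ?f i j"] sum_nonneg) auto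
  finally show ?thesis .
qed

text \<open>Green's formula with both arguments equal to \<open>X\<close> shows that the energy
  vanishes, and with it every edge term. Stating the result edge by edge avoids any reference to
  connected components.\<close>

lemma harmonic_imp_eq_on_edges:
  fixes X :: "real ^ 'd::finite ^ 'n"
  assumes "laplacian G X = 0" "adjacent G i j"
  shows "X $ j = X $ i"
proof -
  have "energy G X = 0"
    using summation_by_parts[of X X] assms(1) by (simp add: energy_eq power2_norm_eq_inner)
  then show ?thesis
    using weight_diff_le_energy[OF assms(2), of X] weight_pos[OF assms(2)]
    by (simp add: mult_le_0_iff)
qed

text \<open>At each vertex the Laplacian is a finite combination of edge differences, and each
  difference is at most the square root of the energy over the edge weight.\<close>

lemma total_sq_laplacian_le_energy:
  "\<exists>M>0. \<forall>X :: real ^ 'd::finite ^ 'n. total_sq_laplacian G X \<le> M * energy G X"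
proof -
  \<comment> \<open>\<open>k i\<close> collects the coefficients of the Laplacian at
    \<open>i\<close>, each multiplied by the factor \<open>1 / sqrt (weight G i j)\<close> from the
    bound on the difference.\<close>
  define k where "k i = (\<Sum>j | adjacent G i j. weight G i j / vmeasure G i / sqrt (weight G i j))" for i
  define M where "M = (\<Sum>i\<in>UNIV. (k i)\<^sup>2 * vmeasure G i)"
  have "M \<ge> 0"
    unfolding M_def by (intro sum_nonneg) (simp add: vmeasure_pos less_imp_le)
  have "total_sq_laplacian G X \<le> M * energy G X" for X :: "real ^ 'd::finite ^ 'n"
  proof -
    have diff: "norm (X $ j - X $ i) \<le> sqrt (energy G X) / sqrt (weight G i j)"
      if "adjacent G i j" for i j
    proof -
      have "(norm (X $ j - X $ i))\<^sup>2 \<le> energy G X / weight G i j"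
        using weight_diff_le_energy[OF that, of X] weight_pos[OF that] by (simp add: field_simps)
      then show ?thesis by (metis real_le_rsqrt real_sqrt_divide)
    qed
    have "(norm (laplacian G X $ i))\<^sup>2 \<le> (k i)\<^sup>2 * energy G X" for i
    proof -
      have "norm (laplacian G X $ i)
          \<le> (\<Sum>j | adjacent G i j. weight G i j / vmeasure G i * norm (X $ j - X $ i))"
        unfolding laplacian_def vec_lambda_beta
        by (intro sum_norm_le)
          (use weight_pos vmeasure_pos[of i] in \<open>auto simp: abs_of_pos\<close>)
      also have "\<dots> \<le> (\<Sum>j | adjacent G i j. weight G i j / vmeasure G i
          * (sqrt (energy G X) / sqrt (weight G i j)))"
        using weight_pos vmeasure_pos[of i] diff
        by (intro sum_mono mult_left_mono) (auto simp: less_imp_le)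
      also have "\<dots> = k i * sqrt (energy G X)"
        by (simp add: k_def sum_distrib_right)
      finally have "(norm (laplacian G X $ i))\<^sup>2 \<le> (k i * sqrt (energy G X))\<^sup>2"
        by (intro power_mono) auto
      then show ?thesis by (simp add: power_mult_distrib energy_nonneg)
    qed
    then have "total_sq_laplacian G X \<le> (\<Sum>i\<in>UNIV. ((k i)\<^sup>2 * energy G X) * vmeasure G i)"
      unfolding graph_integral_def[of G "sq_laplacian G X"] sq_laplacian_def
      using vmeasure_pos by (intro sum_mono mult_right_mono) (auto simp: less_imp_le)
    also have "\<dots> = M * energy G X"
      unfolding M_def sum_distrib_right by (intro sum.cong) auto
    finally show ?thesis .
  qed
  \<comment> \<open>\<open>M\<close> is zero for a graph without edges; adding 1 makes the constant
    positive.\<close>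
  then have "total_sq_laplacian G X \<le> (M + 1) * energy G X" for X :: "real ^ 'd::finite ^ 'n"
    using energy_nonneg[of X] by (simp add: distrib_right add_increasing2)
  then show ?thesis using \<open>M \<ge> 0\<close> by (intro exI[of _ "M + 1"]) auto
qed

text \<open>
  A linear right inverse \<open>g\<close> of the Laplacian on its range replaces a spectral gap: \<open>X\<close> and
  \<open>g (\<Delta> X)\<close> differ by a harmonic function, which carries no energy.
\<close>

lemma energy_le_total_sq_laplacian:
  "\<exists>K>0. \<forall>X :: real ^ 'd::finite ^ 'n. energy G X \<le> K * total_sq_laplacian G X"
proof -
  let ?\<Delta> = "laplacian G :: real ^ 'd ^ 'n \<Rightarrow> real ^ 'd ^ 'n"
  obtain g where "linear g" and g: "\<And>X. ?\<Delta> (g (?\<Delta> X)) = ?\<Delta> X"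
    using linear_exists_right_inverse_on[OF linear_laplacian subspace_UNIV] by blast
  obtain B where "B > 0" and B: "\<And>Y. norm (g Y) \<le> B * norm Y"
    using linear_bounded_pos[OF \<open>linear g\<close>] by blast
  define W where "W = (\<Sum>i\<in>UNIV. \<Sum>j | adjacent G i j. weight G i j)"
  have "W \<ge> 0"
    unfolding W_def by (intro sum_nonneg) (auto simp: weight_pos less_imp_le)
  define m where "m = Min (range (vmeasure G))"
  have "m > 0" unfolding m_def using vmeasure_pos by simp
  have m: "m \<le> vmeasure G i" for i unfolding m_def by simp
  \<comment> \<open>\<open>W * 4\<close> comes from the energy of \<open>Y\<close>, whose
    differences are at most \<open>2 * norm Y\<close>; \<open>B\<^sup>2\<close> from the bound on
    \<open>g\<close>; and \<open>1 / m\<close> from replacing the unweighted norm of the Laplacian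
    by the integral against the measure.\<close>
  define K where "K = W * 4 * B\<^sup>2 / m"
  have "K \<ge> 0" using \<open>W \<ge> 0\<close> \<open>m > 0\<close> by (simp add: K_def)
  have "energy G X \<le> K * total_sq_laplacian G X" for X :: "real ^ 'd ^ 'n"
  proof -
    define Y where "Y = g (?\<Delta> X)"
    have "?\<Delta> (X - Y) = 0"
      by (simp add: Y_def linear_diff[OF linear_laplacian] g)
    then have same_diff: "X $ j - X $ i = Y $ j - Y $ i" if "adjacent G i j" for i j
      using harmonic_imp_eq_on_edges[OF _ that, of "X - Y"] by (simp add: algebra_simps)
    \<comment> \<open>The norm of \<open>X\<close> cannot be bounded by its Laplacian, since
      constants may be added to \<open>X\<close>; the norm of \<open>Y\<close> can.\<close>
    have diff: "(norm (X $ j - X $ i))\<^sup>2 \<le> 4 * (norm Y)\<^sup>2" if "adjacent G i j" for i j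
    proof -
      have "norm (X $ j - X $ i) \<le> 2 * norm Y"
        using norm_triangle_ineq4[of "Y $ j" "Y $ i"]
          Finite_Cartesian_Product.norm_nth_le[of Y i]
          Finite_Cartesian_Product.norm_nth_le[of Y j]
        unfolding same_diff[OF that] by linarith
      then have "(norm (X $ j - X $ i))\<^sup>2 \<le> (2 * norm Y)\<^sup>2" by (intro power_mono) auto
      then show ?thesis by (simp add: power_mult_distrib)
    qed
    have "energy G X \<le> (\<Sum>i\<in>UNIV. \<Sum>j | adjacent G i j. weight G i j * (4 * (norm Y)\<^sup>2))"
      unfolding energy_eq using diff weight_pos
      by (intro sum_mono mult_left_mono) (auto simp: less_imp_le)
    also have "\<dots> = W * 4 * (norm Y)\<^sup>2"
      by (simp add: W_def sum_distrib_right mult.assoc)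
    also have "\<dots> \<le> W * 4 * (B\<^sup>2 * (norm (?\<Delta> X))\<^sup>2)"
    proof (rule mult_left_mono)
      show "(norm Y)\<^sup>2 \<le> B\<^sup>2 * (norm (?\<Delta> X))\<^sup>2"
        using power_mono[OF B[of "?\<Delta> X"], of 2] by (simp add: Y_def power_mult_distrib)
    qed (use \<open>W \<ge> 0\<close> in simp)
    also have "\<dots> = K * (m * (norm (?\<Delta> X))\<^sup>2)"
      using \<open>m > 0\<close> by (simp add: K_def)
    also have "\<dots> \<le> K * total_sq_laplacian G X"
    proof (rule mult_left_mono[OF _ \<open>K \<ge> 0\<close>])
      have "(norm (?\<Delta> X))\<^sup>2 = (\<Sum>i\<in>UNIV. (norm (?\<Delta> X $ i))\<^sup>2)"
        by (simp add: norm_vec_def L2_set_def sum_nonneg)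
      then have "m * (norm (?\<Delta> X))\<^sup>2 = (\<Sum>i\<in>UNIV. (norm (?\<Delta> X $ i))\<^sup>2 * m)"
        by (simp add: sum_distrib_left mult.commute)
      also have "\<dots> \<le> total_sq_laplacian G X"
        unfolding graph_integral_def sq_laplacian_def
        by (intro sum_mono mult_left_mono m) auto
      finally show "m * (norm (?\<Delta> X))\<^sup>2 \<le> total_sq_laplacian G X" .
    qed
    finally show ?thesis .
  qed
  then have "energy G X \<le> (K + 1) * total_sq_laplacian G X" for X :: "real ^ 'd ^ 'n"
    using total_sq_laplacian_nonneg[of X] by (simp add: distrib_right add_increasing2)
  then show ?thesis using \<open>K \<ge> 0\<close> by (intro exI[of _ "K + 1"]) auto
qed

section \<open>Dissipation of the energy along the flow\<close>

text \<open>Differentiating the squared differences gives one factor 2, and Green's formula applied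
  to \<open>X t\<close> and \<open>X'\<close> gives the other together with the sign.\<close>

lemma energy_has_derivative_along_curve:
  fixes X :: "real \<Rightarrow> real ^ 'd::finite ^ 'n"
  assumes "(X has_vector_derivative X') (at t within S)"
  shows "((\<lambda>s. energy G (X s)) has_real_derivative
      - 4 * (\<Sum>i\<in>UNIV. vmeasure G i * (laplacian G (X t) $ i \<bullet> X' $ i))) (at t within S)"
proof -
  have nth: "((\<lambda>s. X s $ i) has_vector_derivative X' $ i) (at t within S)" for i
    by (rule bounded_linear.has_vector_derivative[OF bounded_linear_vec_nth assms])
  have "((\<lambda>s. (norm (X s $ j - X s $ i))\<^sup>2) has_real_derivative
      2 * ((X t $ j - X t $ i) \<bullet> (X' $ j - X' $ i))) (at t within S)" for i j
    using bounded_bilinear.has_vector_derivative[OF bounded_bilinear_inner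
        has_vector_derivative_diff[OF nth[of j] nth[of i]]
        has_vector_derivative_diff[OF nth[of j] nth[of i]]]
    by (simp add: has_real_derivative_iff_has_vector_derivative power2_norm_eq_inner inner_commute)
  then have "((\<lambda>s. energy G (X s)) has_real_derivative
      (\<Sum>i\<in>UNIV. \<Sum>j | adjacent G i j.
        weight G i j * (2 * ((X t $ j - X t $ i) \<bullet> (X' $ j - X' $ i))))) (at t within S)"
    unfolding energy_eq by (intro DERIV_sum DERIV_cmult)
  also have "(\<Sum>i\<in>UNIV. \<Sum>j | adjacent G i j.
        weight G i j * (2 * ((X t $ j - X t $ i) \<bullet> (X' $ j - X' $ i))))
      = 2 * (\<Sum>i\<in>UNIV. \<Sum>j | adjacent G i j.
        weight G i j * ((X t $ j - X t $ i) \<bullet> (X' $ j - X' $ i)))"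
    by (simp only: sum_distrib_left ac_simps)
  finally show ?thesis
    unfolding summation_by_parts by simp
qed

text \<open>The velocity is a multiple of the Laplacian, whose pairing with itself is
  \<open>total_sq_laplacian\<close>; the non-local coefficient is the same number, so the product is
  a square.\<close>

lemma energy_derivative_along_flow:
  fixes X :: "real \<Rightarrow> real ^ 'd::finite ^ 'n"
  assumes "(X has_vector_derivative total_sq_laplacian G (X t) *\<^sub>R laplacian G (X t)) (at t within S)"
  shows "((\<lambda>s. energy G (X s)) has_real_derivative - 4 * (total_sq_laplacian G (X t))\<^sup>2) (at t within S)"
proof -
  let ?L = "total_sq_laplacian G (X t)"
  have "(\<Sum>i\<in>UNIV. vmeasure G i * (laplacian G (X t) $ i \<bullet> (?L *\<^sub>R laplacian G (X t)) $ i))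
      = ?L * (\<Sum>i\<in>UNIV. vmeasure G i * (laplacian G (X t) $ i \<bullet> laplacian G (X t) $ i))"
    by (simp add: sum_distrib_left mult.left_commute)
  also have "(\<Sum>i\<in>UNIV. vmeasure G i * (laplacian G (X t) $ i \<bullet> laplacian G (X t) $ i)) = ?L"
    by (simp add: graph_integral_def sq_laplacian_def power2_norm_eq_inner mult.commute)
  finally show ?thesis
    using energy_has_derivative_along_curve[OF assms] by (simp add: power2_eq_square)
qed

end

theorem theorem4p1:
  fixes G :: "'n::finite wgraph"
  assumes "weighted_graph G"
  shows "\<exists>C\<^sub>1 C\<^sub>2 :: real. C\<^sub>1 > 0 \<and> C\<^sub>2 > 0 \<and>
    (\<forall>(X\<^sub>0 :: real ^ 'd::finite ^ 'n) (X :: real \<Rightarrow> real ^ 'd ^ 'n).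
      X 0 = X\<^sub>0 \<longrightarrow>
      (\<forall>t\<ge>0. (X has_vector_derivative
                graph_integral G (sq_laplacian G (X t)) *\<^sub>R laplacian G (X t))
              (at t within {0..})) \<longrightarrow>
      (\<forall>t>0.
        min (C\<^sub>2 * graph_integral G (sq_gradient G X\<^sub>0)) (C\<^sub>2 * (1 / t))
          \<le> graph_integral G (sq_gradient G (X t)) \<and>
        graph_integral G (sq_gradient G (X t)) \<le> C\<^sub>1 * (1 / t)))"
proof -
  obtain M where "M > 0"
    and M: "\<And>X :: real ^ 'd ^ 'n. total_sq_laplacian G X \<le> M * energy G X"
    using total_sq_laplacian_le_energy[OF assms] by blast
  obtain K where "K > 0"
    and K: "\<And>X :: real ^ 'd ^ 'n. energy G X \<le> K * total_sq_laplacian G X"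
    using energy_le_total_sq_laplacian[OF assms] by blast
  \<comment> \<open>With \<open>y\<close> the energy and \<open>L\<close> the integrated squared
    Laplacian, \<open>y \<le> K * L\<close> turns \<open>y' = - 4 * L\<^sup>2\<close> into the upper
    Riccati inequality with \<open>a\<close>, and \<open>L \<le> M * y\<close> into the lower one
    with \<open>b\<close>. Both constants are fixed before any solution is chosen.\<close>
  define a where "a = 4 / K\<^sup>2"
  define b where "b = 4 * M\<^sup>2"
  have "a > 0" "b > 0" using \<open>K > 0\<close> \<open>M > 0\<close> by (auto simp: a_def b_def)
  \<comment> \<open>One constant has to serve both terms of the minimum, so \<open>C\<close> is the
    smaller of the coefficients 1/2 and \<open>1 / (2 * b)\<close> supplied by
    \<open>riccati_bounds\<close>.\<close>
  define C where "C = min (1 / 2) (1 / (2 * b))"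
  have "C > 0" using \<open>b > 0\<close> by (simp add: C_def)
  have "min (C * energy G (X 0)) (C * (1 / t)) \<le> energy G (X t) \<and> energy G (X t) \<le> 1 / a * (1 / t)"
    if flow: "\<And>s. s \<ge> 0 \<Longrightarrow> (X has_vector_derivative
        total_sq_laplacian G (X s) *\<^sub>R laplacian G (X s)) (at s within {0..})"
      and "t > 0" for X :: "real \<Rightarrow> real ^ 'd ^ 'n" and t
  proof -
    let ?y = "\<lambda>s. energy G (X s)" and ?L = "\<lambda>s. total_sq_laplacian G (X s)"
    \<comment> \<open>Both comparisons may be squared because the energy and the integrated squared
      Laplacian are nonnegative.\<close>
    have up: "- 4 * (?L s)\<^sup>2 \<le> - a * (?y s)\<^sup>2" for s
      using power_mono[OF K energy_nonneg[OF assms], of "X s" 2] \<open>K > 0\<close>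
      by (simp add: a_def power_mult_distrib field_simps)
    have lo: "- b * (?y s)\<^sup>2 \<le> - 4 * (?L s)\<^sup>2" for s
      using power_mono[OF M total_sq_laplacian_nonneg[OF assms], of "X s" 2]
      by (simp add: b_def power_mult_distrib)
    note bounds = riccati_bounds[OF energy_derivative_along_flow[OF assms flow]
        energy_nonneg[OF assms] up lo \<open>a > 0\<close> \<open>b > 0\<close> \<open>t > 0\<close>]
    have "C * ?y 0 \<le> 1 / 2 * ?y 0"
      by (intro mult_right_mono energy_nonneg[OF assms]) (simp add: C_def)
    moreover have "C * (1 / t) \<le> 1 / (2 * b) * (1 / t)"
      using \<open>t > 0\<close> by (intro mult_right_mono) (auto simp: C_def)
    ultimately have "min (C * ?y 0) (C * (1 / t)) \<le> min (?y 0 / 2) (1 / (2 * b * t))"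
      using min.mono[of "C * ?y 0" "?y 0 / 2" "C * (1 / t)" "1 / (2 * b * t)"]
      by (simp del: min.bounded_iff)
    also note bounds(2)
    finally show ?thesis using bounds(1) by simp
  qed
  then show ?thesis
    using \<open>a > 0\<close> \<open>C > 0\<close> by (intro exI[of _ "1 / a"] exI[of _ C]) auto
qed

end
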